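(* Let $\lambda_0\ge 1$ be an integer, $\rho>1$ a real number, and $\lambda_k=\lceil\lambda_0\rho^k\rceil$ for $k\ge 0$. Let $\mathcal{L}^\times(\hat\lambda,\rho)$ be the loss function of this restart strategy, and let $$\mathcal{L}^\times_{\mathrm{low}}(\hat\lambda,\rho)=\frac{\hat\lambda-1-\lambda_0}{\rho-1}.$$ Then $\mathcal{L}^\times_{\mathrm{low}}(\hat\lambda,\rho)$ is a lower bound of $\mathcal{L}^\times(\hat\lambda,\rho)$, i.e. $\mathcal{L}^\times(\hat\lambda,\rho)\ge\mathcal{L}^\times_{\mathrm{low}}(\hat\lambda,\rho)$ for all integers $\hat\lambda\ge\lambda_0$.
   Context: For a restart strategy $(\lambda_0,\lambda_1,\lambda_2,\ldots)$ (an unbounded sequence of natural numbers) and an integer $\hat\lambda\ge\lambda_0$, let $\hat k(\hat\lambda)=\min\{k\ge 0:\lambda_k\ge\hat\lambda\}$. The loss function is $\mathcal{L}(\hat\lambda)=\sum_{k=0}^{\hat k(\hat\lambda)}\lambda_k-\hat\lambda$; it is denoted $\mathcal{L}^\times(\hat\lambda,\rho)$ for the strategy $\lambda_k=\lceil\lambda_0\rho^k\rceil$. *)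

theory Defs
  imports Complex_Main
begin

definition restart_strategy :: "(nat \<Rightarrow> nat) \<Rightarrow> bool" where
  "restart_strategy lam \<longleftrightarrow> (\<forall>b. \<exists>k. lam k > b)"

text \<open>For a restart strategy the set of such \<open>k\<close> is nonempty, so \<open>LEAST\<close> is its minimum.\<close>

definition khat :: "(nat \<Rightarrow> nat) \<Rightarrow> nat \<Rightarrow> nat" where
  "khat lam lamhat = (LEAST k. lam k \<ge> lamhat)"

text \<open>The loss is integer-valued, which avoids truncated subtraction on naturals.\<close>

definition loss :: "(nat \<Rightarrow> nat) \<Rightarrow> nat \<Rightarrow> int" where
  "loss lam lamhat = (\<Sum>k = 0..khat lam lamhat. int (lam k)) - int lamhat"

definition mult_strategy :: "nat \<Rightarrow> real \<Rightarrow> nat \<Rightarrow> nat" where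
  "mult_strategy lam0 \<rho> k = nat \<lceil>real lam0 * \<rho> ^ k\<rceil>"

definition loss_mult :: "nat \<Rightarrow> nat \<Rightarrow> real \<Rightarrow> int" where
  "loss_mult lam0 lamhat \<rho> = loss (mult_strategy lam0 \<rho>) lamhat"

definition loss_mult_low :: "nat \<Rightarrow> nat \<Rightarrow> real \<Rightarrow> real" where
  "loss_mult_low lam0 lamhat \<rho> = (real lamhat - 1 - real lam0) / (\<rho> - 1)"

lemma mult_strategy_0 [simp]: "mult_strategy lam0 \<rho> 0 = lam0"
  by (simp add: mult_strategy_def)

lemma restart_strategy_mult_strategy:
  assumes "lam0 \<ge> 1" and "\<rho> > 1"
  shows "restart_strategy (mult_strategy lam0 \<rho>)"
  unfolding restart_strategy_def
proof
  fix b :: nat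
  obtain k where k: "real b < \<rho> ^ k"
    using real_arch_pow[OF assms(2)] by blast
  have "1 * \<rho> ^ k \<le> real lam0 * \<rho> ^ k"
    using assms by (intro mult_right_mono) auto
  with k have "real b < real lam0 * \<rho> ^ k" by linarith
  then have "b < mult_strategy lam0 \<rho> k"
    unfolding mult_strategy_def by (simp add: zless_nat_eq_int_zless less_ceiling_iff)
  then show "\<exists>k. mult_strategy lam0 \<rho> k > b" ..
qed

end

theory Submission
  imports Defs
begin

text \<open>
  With \<open>K = khat\<close>, the last term is at least \<open>lamhat\<close>, so the loss is at least
  the sum of the first \<open>K\<close> terms. Dropping the ceilings there gives the geometric sum
  \<open>lam0 * (\<rho> ^ K - 1) / (\<rho> - 1)\<close>, and \<open>lam0 * \<rho> ^ K > lamhat - 1\<close>, as the ceiling of the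
  left-hand side is at least \<open>lamhat\<close>.
\<close>

lemma le_mult_strategy: "real lam0 * \<rho> ^ k \<le> real (mult_strategy lam0 \<rho> k)"
  unfolding mult_strategy_def by (rule real_nat_ceiling_ge)

text \<open>A ceiling exceeds its argument by less than 1; \<open>\<rho> \<ge> 0\<close> keeps
  \<open>nat\<close> from raising a negative ceiling to 0.\<close>

lemma mult_strategy_less:
  assumes "\<rho> \<ge> 0"
  shows "real (mult_strategy lam0 \<rho> k) < real lam0 * \<rho> ^ k + 1"
proof -
  have "0 \<le> real lam0 * \<rho> ^ k" using assms by simp
  then show ?thesis unfolding mult_strategy_def by linarith
qed

lemma le_lam_khat:
  assumes "restart_strategy lam"
  shows "lamhat \<le> lam (khat lam lamhat)"
proof -
  obtain k where "lam k > lamhat"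
    using assms unfolding restart_strategy_def by blast
  then have "lamhat \<le> lam k" by simp
  then show ?thesis unfolding khat_def by (rule LeastI)
qed

lemma sum_lessThan_khat_le_loss:
  assumes "restart_strategy lam"
  shows "(\<Sum>k<khat lam lamhat. int (lam k)) \<le> loss lam lamhat"
  using le_lam_khat[OF assms, of lamhat]
  \<comment> \<open>Splitting off the term at index \<open>khat\<close> leaves it to absorb the
    subtracted \<open>lamhat\<close>.\<close>
  by (simp add: loss_def atLeast0AtMost lessThan_Suc_atMost[symmetric])

theorem theorem4:
  fixes lam0 :: nat and \<rho> :: real
  assumes "lam0 \<ge> 1" and "\<rho> > 1"
  shows "\<forall>lamhat::nat. lamhat \<ge> lam0 \<longrightarrow>
    real_of_int (loss_mult lam0 lamhat \<rho>) \<ge> loss_mult_low lam0 lamhat \<rho>"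
proof (intro allI impI)
  fix lamhat :: nat
  let ?lam = "mult_strategy lam0 \<rho>"
  define K where "K = khat ?lam lamhat"
  have restart: "restart_strategy ?lam"
    using assms by (rule restart_strategy_mult_strategy)
  have "real lamhat \<le> real (?lam K)"
    using le_lam_khat[OF restart] by (simp add: K_def)
  also have "\<dots> < real lam0 * \<rho> ^ K + 1"
    using assms(2) by (intro mult_strategy_less) simp
  \<comment> \<open>Subtracting \<open>lam0\<close> on both sides turns the right-hand side into the
    numerator of the geometric sum.\<close>
  finally have "real lamhat - 1 - real lam0 \<le> real lam0 * (\<rho> ^ K - 1)"
    by (simp add: algebra_simps)
  then have "loss_mult_low lam0 lamhat \<rho> \<le> real lam0 * (\<rho> ^ K - 1) / (\<rho> - 1)"
    unfolding loss_mult_low_def using assms(2) by (intro divide_right_mono) auto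
  also have "\<dots> = (\<Sum>k<K. real lam0 * \<rho> ^ k)"
    using assms(2) by (simp add: geometric_sum flip: sum_distrib_left)
  also have "\<dots> \<le> (\<Sum>k<K. real (?lam k))"
    by (intro sum_mono le_mult_strategy)
  also have "\<dots> = real_of_int (\<Sum>k<K. int (?lam k))"
    by simp
  also have "\<dots> \<le> real_of_int (loss_mult lam0 lamhat \<rho>)"
    using sum_lessThan_khat_le_loss[OF restart] unfolding loss_mult_def K_def of_int_le_iff .
  finally show "loss_mult_low lam0 lamhat \<rho> \<le> real_of_int (loss_mult lam0 lamhat \<rho>)" .
qed

end
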